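(* Let $k\geq 3$ and $n\geq 1$ be integers and let $H_n^k$ be the Tower of Hanoi graph with $n$ disks and $k$ pegs. Then the automorphism group $G(H_n^k)$ of $H_n^k$ is isomorphic to the symmetric group $S_k$.
   Context: The Tower of Hanoi puzzle has $k$ pegs labeled $0,\ldots,k-1$ and $n$ disks of pairwise different sizes labeled $0,\ldots,n-1$ (disk $0$ smallest, disk $n-1$ largest). A legal state is a placement of all disks on pegs with no disk on top of a smaller one; it is encoded by the string $a_{n-1}a_{n-2}\cdots a_0$ with $a_i\in\{0,\ldots,k-1\}$ meaning disk $i$ lies on peg $a_i$ (every such string corresponds to exactly one legal state). The graph $H_n^k$ has vertex set the $k^n$ such strings, and two vertices are joined by a single edge iff one state is obtained from the other by a single legal move, i.e. moving the topmost (smallest) disk of some peg onto another peg that is empty or whose topmost disk is larger. Equivalently, $a_{n-1}\cdots a_0$ and $b_{n-1}\cdots b_0$ are adjacent iff they differ in exactly one position $i$ and no disk $j<i$ has $a_j\in\{a_i,b_i\}$. An automorphism is an adjacency-preserving bijection of the vertex set; $G(H_n^k)$ is the group of automorphisms. *)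

theory Defs
  imports
    "HOL-Algebra.Bij"
    "HOL-Algebra.Sym_Groups"
    "Graph_Theory.Pair_Digraph"
begin

text \<open>
  The string \<open>a\<^sub>n\<^sub>-\<^sub>1 \<dots> a\<^sub>0\<close> is the extensional function mapping disk \<open>i\<close> to its peg \<open>a i\<close>.
\<close>

definition hanoi_states :: "nat \<Rightarrow> nat \<Rightarrow> (nat \<Rightarrow> nat) set" where
  "hanoi_states k n = {..<n} \<rightarrow>\<^sub>E {..<k}"

definition disks_on :: "nat \<Rightarrow> (nat \<Rightarrow> nat) \<Rightarrow> nat \<Rightarrow> nat set" where
  "disks_on n a p = {i. i < n \<and> a i = p}"

text \<open>Disk 0 is the smallest one, so the topmost disk of a nonempty peg is the \<open>Min\<close> of its disks.\<close>

definition legal_move :: "nat \<Rightarrow> nat \<Rightarrow> (nat \<Rightarrow> nat) \<Rightarrow> (nat \<Rightarrow> nat) \<Rightarrow> bool" where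
  "legal_move k n a b \<longleftrightarrow>
     (\<exists>p<k. \<exists>q<k. p \<noteq> q \<and> disks_on n a p \<noteq> {} \<and>
        (disks_on n a q = {} \<or> Min (disks_on n a p) < Min (disks_on n a q)) \<and>
        b = a(Min (disks_on n a p) := q))"

text \<open>Undirected graphs are loop-free digraphs with a symmetric arc relation (\<open>pair_graph\<close>).\<close>

definition hanoi_graph :: "nat \<Rightarrow> nat \<Rightarrow> (nat \<Rightarrow> nat) pair_pre_digraph" where
  "hanoi_graph k n =
     \<lparr>pverts = hanoi_states k n,
      parcs = {(a, b). a \<in> hanoi_states k n \<and> b \<in> hanoi_states k n \<and>
                       (legal_move k n a b \<or> legal_move k n b a)}\<rparr>"

definition graph_automorphisms :: "'a pair_pre_digraph \<Rightarrow> ('a \<Rightarrow> 'a) set" where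
  "graph_automorphisms G =
     {f \<in> Bij (pverts G). \<forall>u\<in>pverts G. \<forall>v\<in>pverts G. (f u, f v) \<in> parcs G \<longleftrightarrow> (u, v) \<in> parcs G}"

definition graph_aut_group :: "'a pair_pre_digraph \<Rightarrow> ('a \<Rightarrow> 'a) monoid" where
  "graph_aut_group G = BijGroup (pverts G) \<lparr>carrier := graph_automorphisms G\<rparr>"

lemma subgroup_graph_automorphisms:
  "subgroup (graph_automorphisms G) (BijGroup (pverts G))"
proof (rule subgroup.intro)
  show "graph_automorphisms G \<subseteq> carrier (BijGroup (pverts G))"
    by (auto simp: graph_automorphisms_def BijGroup_def)
next
  fix f g assume fg: "f \<in> graph_automorphisms G" "g \<in> graph_automorphisms G"
  then have "g u \<in> pverts G" if "u \<in> pverts G" for u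
    using that by (auto simp: graph_automorphisms_def dest: Bij_imp_funcset)
  with fg show "f \<otimes>\<^bsub>BijGroup (pverts G)\<^esub> g \<in> graph_automorphisms G"
    by (auto simp: graph_automorphisms_def BijGroup_def compose_Bij compose_eq)
next
  show "\<one>\<^bsub>BijGroup (pverts G)\<^esub> \<in> graph_automorphisms G"
    by (auto simp: graph_automorphisms_def BijGroup_def id_Bij)
next
  fix f assume f: "f \<in> graph_automorphisms G"
  then have B: "f \<in> Bij (pverts G)" by (simp add: graph_automorphisms_def)
  have im: "f (inv_into (pverts G) f u) = u" if "u \<in> pverts G" for u
    using B that by (auto simp: Bij_def bij_betw_def f_inv_into_f)
  have "(inv_into (pverts G) f u, inv_into (pverts G) f v) \<in> parcs G \<longleftrightarrow> (u, v) \<in> parcs G"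
    if "u \<in> pverts G" "v \<in> pverts G" for u v
    using f im[OF that(1)] im[OF that(2)] Bij_inv_into_mem[OF B that(1)]
      Bij_inv_into_mem[OF B that(2)]
    unfolding graph_automorphisms_def by fastforce
  then show "inv\<^bsub>BijGroup (pverts G)\<^esub> f \<in> graph_automorphisms G"
    by (simp add: inv_BijGroup[OF B] graph_automorphisms_def restrict_inv_into_Bij[OF B])
qed

lemma group_graph_aut_group: "group (graph_aut_group G)"
  unfolding graph_aut_group_def
  by (rule subgroup.subgroup_is_group[OF subgroup_graph_automorphisms group_BijGroup])

lemma card_hanoi_states: "card (hanoi_states k n) = k ^ n"
  by (simp add: hanoi_states_def card_PiE)

lemma legal_move_iff:
  assumes a: "a \<in> hanoi_states k n"
  shows "legal_move k n a b \<longleftrightarrow>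
    (\<exists>i<n. \<exists>q<k. q \<noteq> a i \<and> (\<forall>j<i. a j \<noteq> a i \<and> a j \<noteq> q) \<and> b = a(i := q))"
    (is "_ \<longleftrightarrow> ?R")
proof -
  have fin: "finite (disks_on n a p)" for p by (simp add: disks_on_def)
  have ?R if "legal_move k n a b"
  proof -
    from that obtain p q where pq: "p < k" "q < k" "p \<noteq> q" and ne: "disks_on n a p \<noteq> {}"
      and top: "disks_on n a q = {} \<or> Min (disks_on n a p) < Min (disks_on n a q)"
      and b: "b = a(Min (disks_on n a p) := q)"
      by (auto simp: legal_move_def)
    let ?i = "Min (disks_on n a p)"
    have i: "?i < n" "a ?i = p" using Min_in[OF fin ne] by (auto simp: disks_on_def)
    have "a j \<noteq> p" "a j \<noteq> q" if "j < ?i" for j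
    proof -
      have jn: "j < n" using that i by simp
      show "a j \<noteq> p"
      proof
        assume "a j = p"
        then have "j \<in> disks_on n a p" using jn by (simp add: disks_on_def)
        from Min_le[OF fin this] that show False by simp
      qed
      show "a j \<noteq> q"
      proof
        assume "a j = q"
        then have j: "j \<in> disks_on n a q" using jn by (simp add: disks_on_def)
        with top have "?i < Min (disks_on n a q)" by auto
        with Min_le[OF fin j] that show False by simp
      qed
    qed
    then show ?R using i pq b by (intro exI[of _ ?i] exI[of _ q] conjI) auto
  qed
  moreover have "legal_move k n a b" if ?R
  proof -
    from that obtain i q where i: "i < n" "q < k" "q \<noteq> a i"
      and free: "\<forall>j<i. a j \<noteq> a i \<and> a j \<noteq> q" and b: "b = a(i := q)" by blast
    have ak: "a i < k" using a i by (auto simp: hanoi_states_def)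
    have mem: "i \<in> disks_on n a (a i)" using i by (simp add: disks_on_def)
    have M: "Min (disks_on n a (a i)) = i"
      using free mem by (intro Min_eqI fin) (auto simp: disks_on_def intro: leI)
    have "disks_on n a q = {} \<or> i < Min (disks_on n a q)"
    proof (cases "disks_on n a q = {}")
      case False
      from Min_in[OF fin False] have m: "a (Min (disks_on n a q)) = q" by (simp add: disks_on_def)
      then have "\<not> Min (disks_on n a q) < i" "Min (disks_on n a q) \<noteq> i" using free i by auto
      then show ?thesis by simp
    qed simp
    then show "legal_move k n a b" unfolding legal_move_def
      using M mem ak i b by (intro exI[of _ "a i"] exI[of _ q] conjI) auto
  qed
  ultimately show ?thesis by blast
qed

lemma legal_move_sym:
  assumes a: "a \<in> hanoi_states k n" and ab: "legal_move k n a b"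
  shows "b \<in> hanoi_states k n" "legal_move k n b a"
proof -
  obtain i q where i: "i < n" "q < k" "q \<noteq> a i"
    and free: "\<forall>j<i. a j \<noteq> a i \<and> a j \<noteq> q" and b: "b = a(i := q)"
    using ab legal_move_iff[OF a] by blast
  show bs: "b \<in> hanoi_states k n"
    using a i b by (auto simp: hanoi_states_def PiE_iff extensional_def)
  have "a i < k" using a i by (auto simp: hanoi_states_def)
  then show "legal_move k n b a" unfolding legal_move_iff[OF bs]
    using i free b by (intro exI[of _ i] exI[of _ "a i"] conjI) auto
qed

lemma hanoi_graph_arc_iff:
  "(a, b) \<in> parcs (hanoi_graph k n) \<longleftrightarrow>
     a \<in> hanoi_states k n \<and> b \<in> hanoi_states k n \<and>
     (\<exists>i<n. a i \<noteq> b i \<and> (\<forall>j<n. j \<noteq> i \<longrightarrow> a j = b j) \<and> (\<forall>j<i. a j \<notin> {a i, b i}))"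
  (is "?L \<longleftrightarrow> ?A \<and> ?B \<and> ?R")
proof
  assume ?L
  then have ab: "?A" "?B" and "legal_move k n a b \<or> legal_move k n b a"
    by (auto simp: hanoi_graph_def)
  then have "legal_move k n a b" using legal_move_sym(2) by blast
  then obtain i q where "i < n" "q \<noteq> a i" "\<forall>j<i. a j \<noteq> a i \<and> a j \<noteq> q" "b = a(i := q)"
    using legal_move_iff[OF ab(1)] by blast
  then have ?R by (intro exI[of _ i]) auto
  with ab show "?A \<and> ?B \<and> ?R" by blast
next
  assume R: "?A \<and> ?B \<and> ?R"
  then obtain i where i: "i < n" "a i \<noteq> b i" "\<forall>j<n. j \<noteq> i \<longrightarrow> a j = b j"
    "\<forall>j<i. a j \<notin> {a i, b i}" by blast
  have "b = a(i := b i)"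
  proof
    fix j show "b j = (a(i := b i)) j"
      using R i by (cases "j < n") (auto simp: hanoi_states_def PiE_iff extensional_def)
  qed
  moreover have "b i < k" using R i by (auto simp: hanoi_states_def)
  ultimately have "legal_move k n a b"
    using R i by (subst legal_move_iff, blast) (metis insertCI)
  then show ?L using R by (simp add: hanoi_graph_def)
qed

lemma pair_graph_hanoi_graph: "pair_graph (hanoi_graph k n)"
proof
  fix e assume "e \<in> parcs (hanoi_graph k n)"
  then show "fst e \<in> pverts (hanoi_graph k n)" "snd e \<in> pverts (hanoi_graph k n)"
    by (auto simp: hanoi_graph_def)
  show "fst e \<noteq> snd e"
    using \<open>e \<in> parcs (hanoi_graph k n)\<close> by (cases e) (auto simp: hanoi_graph_arc_iff)
next
  show fin: "finite (pverts (hanoi_graph k n))"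
    by (simp add: hanoi_graph_def hanoi_states_def finite_PiE)
  show "finite (parcs (hanoi_graph k n))"
    by (rule finite_subset[of _ "pverts (hanoi_graph k n) \<times> pverts (hanoi_graph k n)"])
      (use fin in \<open>auto simp: hanoi_graph_def\<close>)
next
  show "symmetric (with_proj (hanoi_graph k n))"
    by (auto simp: symmetric_def sym_def hanoi_graph_def)
qed

end

(* Moves of the smallest disk are exactly the edges lying in a clique of size k: a clique moving a
   larger disk has to avoid the peg of the smallest one.  Hence an automorphism permutes these
   k-cliques, and since k \<ge> 3 contracting them turns the graph on n + 1 disks into the one on n disks.
   By induction the induced automorphism is a peg permutation \<pi>.  If the second smallest disk is on
   peg p and can move to q, the edges between the two cliques involved are those with the smallest
   disk off {p, q}; comparing these pairs for all q forces the smallest disk to follow \<pi> as well. *)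

theory Submission
  imports Defs
begin

section \<open>Adding and removing the smallest disk\<close>

text \<open>In \<open>case_nat x a\<close> a new smallest disk 0 stands on peg \<open>x\<close>, and
  disk \<open>i\<close> of \<open>a\<close> becomes disk \<open>Suc i\<close>; \<open>a 0\<close>
  and \<open>a \<circ> Suc\<close> undo this. The later induction strips off the smallest
  disk.\<close>

lemma hanoi_states_case_nat_iff:
  "case_nat x a \<in> hanoi_states k (Suc n) \<longleftrightarrow> x < k \<and> a \<in> hanoi_states k n"
proof -
  have "(\<forall>i\<in>{..<Suc n}. case_nat x a i < k) \<longleftrightarrow> x < k \<and> (\<forall>i\<in>{..<n}. a i < k)"
    by (simp flip: lessThan_Suc_atMost add: lessThan_Suc_eq_insert_0)
  moreover have "(\<forall>i. \<not> i < Suc n \<longrightarrow> case_nat x a i = undefined) \<longleftrightarrow> (\<forall>i. \<not> i < n \<longrightarrow> a i = undefined)"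
    by (auto split: nat.splits)
  ultimately show ?thesis
    by (simp add: hanoi_states_def PiE_iff extensional_def)
qed

lemma case_nat_eta: "case_nat (a 0) (a \<circ> Suc) = a"
  by (auto simp: fun_eq_iff split: nat.splits)

lemma hanoi_states_SucE:
  assumes "a \<in> hanoi_states k (Suc n)"
  obtains x b where "a = case_nat x b" "x < k" "b \<in> hanoi_states k n"
  using assms case_nat_eta[of a] hanoi_states_case_nat_iff[of "a 0" "a \<circ> Suc"] by metis

lemma case_nat_inject: "case_nat x a = case_nat y b \<longleftrightarrow> x = y \<and> a = b"
  by (metis (no_types, lifting) ext old.nat.simps(4,5))

text \<open>Disk 0 can always move, so the states over one \<open>a\<close> form a k-clique. A
  larger disk moves as if disk 0 were absent, provided disk 0 is off both pegs involved. The
  condition \<open>a i \<noteq> b i\<close> singles out the moved disk without naming it.\<close>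

lemma hanoi_graph_arc_case_nat_iff:
  assumes "a \<in> hanoi_states k n" "b \<in> hanoi_states k n" "x < k" "y < k"
  shows "(case_nat x a, case_nat y b) \<in> parcs (hanoi_graph k (Suc n)) \<longleftrightarrow>
    a = b \<and> x \<noteq> y \<or>
    x = y \<and> (a, b) \<in> parcs (hanoi_graph k n) \<and> (\<forall>i<n. a i \<noteq> b i \<longrightarrow> x \<notin> {a i, b i})"
proof -
  have eq: "a = b \<longleftrightarrow> (\<forall>i<n. a i = b i)"
    using assms by (auto simp: hanoi_states_def intro!: PiE_ext[of a "{..<n}" "\<lambda>_. {..<k}" b])
  show ?thesis
    unfolding hanoi_graph_arc_iff eq using assms
    by (simp add: hanoi_states_case_nat_iff Ex_less_Suc2 All_less_Suc2) blast
qed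

section \<open>Cliques of size k\<close>

lemma inj_on_lessThan_imp_bij_betw:
  fixes f :: "nat \<Rightarrow> nat"
  assumes "inj_on f {..<k}" "\<And>x. x < k \<Longrightarrow> f x < k"
  shows "bij_betw f {..<k} {..<k}"
  using assms endo_inj_surj[of "{..<k}" f] by (auto simp: bij_betw_def image_subset_iff)

text \<open>If two members differ in a larger disk \<open>i\<close>, all members agree off
  \<open>i\<close>. Disk \<open>i\<close> then stands on k different pegs, never on the common peg
  of disk 0, but only k - 1 pegs remain.\<close>

lemma hanoi_clique_tail_eq:
  assumes k: "k \<ge> 3"
    and adj: "\<And>x y. x < k \<Longrightarrow> y < k \<Longrightarrow> x \<noteq> y \<Longrightarrow> (g x, g y) \<in> parcs (hanoi_graph k (Suc n))"
    and "x < k" "y < k"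
  shows "g x \<circ> Suc = g y \<circ> Suc"
proof (rule ccontr)
  assume ne: "g x \<circ> Suc \<noteq> g y \<circ> Suc"
  then have xy: "x \<noteq> y" by auto
  have st: "g z \<in> hanoi_states k (Suc n)" if "z < k" for z
  proof -
    obtain w where "w < k" "w \<noteq> z" using xy assms(3,4) by metis
    then show ?thesis using adj[of z w] that by (simp add: hanoi_graph_arc_iff)
  qed
  have diff: "\<exists>i<Suc n. g z i \<noteq> g w i \<and> (\<forall>j<Suc n. j \<noteq> i \<longrightarrow> g z j = g w j) \<and>
      (\<forall>j<i. g z j \<notin> {g z i, g w i})"
    if "z < k" "w < k" "z \<noteq> w" for z w
    using adj[OF that] unfolding hanoi_graph_arc_iff by blast
  obtain i where i: "i < Suc n" "g x i \<noteq> g y i" "\<And>j. j < Suc n \<Longrightarrow> j \<noteq> i \<Longrightarrow> g x j = g y j"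
    using diff[OF assms(3,4) xy] by blast
  have i0: "i \<noteq> 0"
  proof
    assume "i = 0"
    then have "g x j = g y j" if "j \<noteq> 0" for j
      using i(3)[of j] that st[OF assms(3)] st[OF assms(4)]
      by (cases "j < Suc n") (auto simp: hanoi_states_def PiE_iff extensional_def)
    then show False using ne by (auto simp: fun_eq_iff)
  qed
  have same: "g z j = g x j" if z: "z < k" and j: "j < Suc n" "j \<noteq> i" for z j
  proof (cases "z = x \<or> z = y")
    case True
    then show ?thesis using i(3)[OF j] by auto
  next
    case False
    then obtain i1 i2 where
      1: "i1 < Suc n" "g z i1 \<noteq> g x i1" "\<And>j. j < Suc n \<Longrightarrow> j \<noteq> i1 \<Longrightarrow> g z j = g x j" and
      2: "i2 < Suc n" "g z i2 \<noteq> g y i2" "\<And>j. j < Suc n \<Longrightarrow> j \<noteq> i2 \<Longrightarrow> g z j = g y j"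
      using diff[OF z assms(3)] diff[OF z assms(4)] by metis
    \<comment> \<open>Otherwise \<open>g z\<close> agrees with \<open>g x\<close> at
      \<open>i\<close>, so \<open>i2 = i\<close>; then at \<open>i1\<close> it agrees with
      \<open>g y\<close>, hence with \<open>g x\<close>, a contradiction.\<close>
    have "i1 = i" using 1 2 i by metis
    with 1 j show ?thesis by blast
  qed
  have neq: "g z i \<noteq> g w i \<and> g z 0 \<notin> {g z i, g w i}" if "z < k" "w < k" "z \<noteq> w" for z w
  proof -
    obtain i' where i': "i' < Suc n" "g z i' \<noteq> g w i'" "\<forall>j<i'. g z j \<notin> {g z i', g w i'}"
      using diff[OF \<open>z < k\<close> \<open>w < k\<close> \<open>z \<noteq> w\<close>] by blast
    have "i' = i" using same[OF that(1) i'(1)] same[OF that(2) i'(1)] i'(2) by metis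
    then show ?thesis using i' i0 by auto
  qed
  have "(\<lambda>z. g z i) ` {..<k} \<subseteq> {..<k} - {g x 0}"
  proof safe
    fix z assume z: "z < k"
    show "g z i < k" using st[OF z] i(1) by (auto simp: hanoi_states_def)
    assume "g z i = g x 0"
    moreover have "g z 0 = g x 0" using same[OF z, of 0] i0 by simp
    moreover obtain w where "w < k" "w \<noteq> z" using xy assms(3,4) by metis
    ultimately show False using neq[of z w] z by auto
  qed
  moreover have "inj_on (\<lambda>z. g z i) {..<k}"
    using neq by (auto simp: inj_on_def)
  ultimately have "k \<le> card ({..<k} - {g x 0})"
    using card_inj_on_le[of "\<lambda>z. g z i" "{..<k}" "{..<k} - {g x 0}"] by simp
  moreover have "g x 0 < k" using st[OF assms(3)] by (auto simp: hanoi_states_def)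
  ultimately show False by simp
qed

section \<open>Every automorphism permutes the pegs\<close>

text \<open>The induction starts at one disk, where the graph is complete and a bijection of the
  states is just a permutation of the pegs. The step reads the fate of the smallest disk off the
  next larger one, so a disk must remain after the removal.\<close>

theorem hanoi_automorphism_peg_permutation:
  assumes k: "k \<ge> 3"
    and "f \<in> graph_automorphisms (hanoi_graph k (Suc n))"
  shows "\<exists>\<pi>. bij_betw \<pi> {..<k} {..<k} \<and>
    (\<forall>a\<in>hanoi_states k (Suc n). \<forall>i<Suc n. f a i = \<pi> (a i))"
  using assms(2)
proof (induction n arbitrary: f)
  case 0
  \<comment> \<open>The one-disk state on peg \<open>x\<close>; \<open>undefined\<close> is the
    value that extensional functions take off their domain.\<close>
  let ?e = "\<lambda>x. case_nat x (\<lambda>_::nat. undefined::nat)"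
  have e: "?e x \<in> hanoi_states k (Suc 0) \<longleftrightarrow> x < k" for x
    unfolding hanoi_states_case_nat_iff by (simp add: hanoi_states_def)
  have ex: "\<exists>x<k. a = ?e x" if "a \<in> hanoi_states k (Suc 0)" for a
    using that by (elim hanoi_states_SucE) (auto simp: hanoi_states_def)
  have bij: "bij_betw f (hanoi_states k (Suc 0)) (hanoi_states k (Suc 0))"
    using 0 by (simp add: graph_automorphisms_def Bij_def hanoi_graph_def)
  define \<pi> where "\<pi> x = f (?e x) 0" for x
  have \<pi>: "\<pi> x < k \<and> f (?e x) = ?e (\<pi> x)" if "x < k" for x
  proof -
    have "f (?e x) \<in> hanoi_states k (Suc 0)" by (rule bspec[OF bij_betwE[OF bij]]) (use that e in blast)
    then obtain y where "y < k" "f (?e x) = ?e y" using ex by blast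
    then show ?thesis by (simp add: \<pi>_def)
  qed
  have "inj_on \<pi> {..<k}"
  proof (rule inj_onI)
    fix x y assume "x \<in> {..<k}" "y \<in> {..<k}" "\<pi> x = \<pi> y"
    then have "f (?e x) = f (?e y)" "?e x \<in> hanoi_states k (Suc 0)" "?e y \<in> hanoi_states k (Suc 0)"
      using \<pi>[of x] \<pi>[of y] e by auto
    then have "?e x = ?e y" by (rule inj_onD[OF bij_betw_imp_inj_on[OF bij]])
    then show "x = y" by (simp add: case_nat_inject)
  qed
  then have "bij_betw \<pi> {..<k} {..<k}"
    using \<pi> by (intro inj_on_lessThan_imp_bij_betw) auto
  moreover have "f a i = \<pi> (a i)" if "a \<in> hanoi_states k (Suc 0)" "i < Suc 0" for a i
    using ex[OF that(1)] \<pi> that(2) by auto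
  ultimately show ?case by blast
next
  case (Suc n)
  let ?S = "hanoi_states k (Suc n)" and ?S' = "hanoi_states k (Suc (Suc n))"
  let ?A = "parcs (hanoi_graph k (Suc n))" and ?A' = "parcs (hanoi_graph k (Suc (Suc n)))"
  have arc: "(f u, f v) \<in> ?A' \<longleftrightarrow> (u, v) \<in> ?A'" if "u \<in> ?S'" "v \<in> ?S'" for u v
    using Suc.prems that by (auto simp: graph_automorphisms_def Bij_def hanoi_graph_def)
  have bij: "bij_betw f ?S' ?S'"
    using Suc.prems by (simp add: graph_automorphisms_def Bij_def hanoi_graph_def)
  \<comment> \<open>\<open>F\<close> is the induced map on contracted cliques and \<open>s a\<close>
    the action inside the clique over \<open>a\<close>. The peg 0 is an arbitrary choice of
    representative, justified by \<open>f_eq\<close>; the restriction to \<open>?S\<close> makes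
    \<open>F\<close> extensional, as \<open>Bij\<close> demands.\<close>
  define F where "F = (\<lambda>a\<in>?S. f (case_nat 0 a) \<circ> Suc)"
  define s where "s a x = f (case_nat x a) 0" for a x
  have mem: "case_nat x a \<in> ?S'" if "x < k" "a \<in> ?S" for x a
    using that by (simp add: hanoi_states_case_nat_iff)
  have f_eq: "f (case_nat x a) = case_nat (s a x) (F a)" if "a \<in> ?S" "x < k" for a x
  proof -
    \<comment> \<open>The image of the clique over \<open>a\<close> is again a k-clique, so it lies
      over a single state.\<close>
    have "(f (case_nat y a), f (case_nat z a)) \<in> ?A'" if "y < k" "z < k" "y \<noteq> z" for y z
      using that \<open>a \<in> ?S\<close> by (simp add: arc mem hanoi_graph_arc_case_nat_iff)
    from hanoi_clique_tail_eq[OF k this, where x = x and y = 0] that k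
    have "f (case_nat x a) \<circ> Suc = F a" by (simp add: F_def)
    then show ?thesis using case_nat_eta[of "f (case_nat x a)"] by (simp add: s_def)
  qed
  have f_in: "s a x < k \<and> F a \<in> ?S" if "a \<in> ?S" "x < k" for a x
    using bij_betwE[OF bij] mem[OF that(2,1)] f_eq[OF that] hanoi_states_case_nat_iff by metis
  then have F_in: "F a \<in> ?S" if "a \<in> ?S" for a
    using that k by (meson less_le_trans zero_less_numeral)
  have s_bij: "bij_betw (s a) {..<k} {..<k}" if "a \<in> ?S" for a
  proof (rule inj_on_lessThan_imp_bij_betw)
    show "inj_on (s a) {..<k}"
    proof (rule inj_onI)
      fix x y assume "x \<in> {..<k}" "y \<in> {..<k}" "s a x = s a y"
      then have "f (case_nat x a) = f (case_nat y a)" using that by (simp add: f_eq)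
      then have "case_nat x a = case_nat y a"
        by (rule inj_onD[OF bij_betw_imp_inj_on[OF bij]])
          (use that mem \<open>x \<in> _\<close> \<open>y \<in> _\<close> in auto)
      then show "x = y" by (simp add: case_nat_inject)
    qed
  qed (use f_in that in blast)
  have s_surj: "\<exists>x<k. s a x = y" if "a \<in> ?S" "y < k" for a y
    using bij_betw_imp_surj_on[OF s_bij[OF that(1)]] that(2) by (metis imageE lessThan_iff)
  have fin: "finite ?S" by (simp add: hanoi_states_def finite_PiE)
  \<comment> \<open>Only surjectivity is shown directly, by taking preimages under \<open>f\<close>;
    injectivity follows since \<open>?S\<close> is finite.\<close>
  have "?S \<subseteq> F ` ?S"
  proof
    fix b assume b: "b \<in> ?S"
    then have "case_nat 0 b \<in> f ` ?S'" using bij_betw_imp_surj_on[OF bij] k mem[of 0 b] by simp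
    then obtain c where c: "c \<in> ?S'" "case_nat 0 b = f c" by blast
    from c(1) obtain x a where "c = case_nat x a" "x < k" "a \<in> ?S" by (rule hanoi_states_SucE)
    with c show "b \<in> F ` ?S" by (auto simp: f_eq case_nat_inject)
  qed
  then have "F ` ?S = ?S" using F_in by blast
  then have F_bij: "bij_betw F ?S ?S"
    using finite_surj_inj[OF fin] by (auto simp: bij_betw_def)
  \<comment> \<open>Every edge of the contracted graph comes from an edge between cliques: with k at
    least 3, disk 0 can be parked on a peg away from both pegs of the move.\<close>
  have lift: "\<exists>x<k. (case_nat x a, case_nat x b) \<in> ?A'" if arc_ab: "(a, b) \<in> ?A" for a b
  proof -
    have ab: "a \<in> ?S" "b \<in> ?S" using arc_ab by (auto simp: hanoi_graph_arc_iff)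
    obtain i where i: "\<forall>j<Suc n. j \<noteq> i \<longrightarrow> a j = b j"
      using arc_ab unfolding hanoi_graph_arc_iff by blast
    have "\<not> {..<k} \<subseteq> {a i, b i}"
    proof
      assume "{..<k} \<subseteq> {a i, b i}"
      from card_mono[OF _ this] have "k \<le> card {a i, b i}" by simp
      also have "\<dots> \<le> 2" by (simp add: card_insert_if)
      finally show False using k by simp
    qed
    then obtain x where x: "x < k" "x \<notin> {a i, b i}" by blast
    then have "\<forall>j<Suc n. a j \<noteq> b j \<longrightarrow> x \<notin> {a j, b j}" using i by metis
    with x(1) arc_ab ab show ?thesis
      by (intro exI[of _ x]) (simp add: hanoi_graph_arc_case_nat_iff)
  qed
  have drop: "(a, b) \<in> ?A"
    if "(case_nat x a, case_nat y b) \<in> ?A'" "a \<noteq> b" "a \<in> ?S" "b \<in> ?S" "x < k" "y < k" for x y a b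
    using that by (simp add: hanoi_graph_arc_case_nat_iff)
  have irrefl: "a \<noteq> b" if "(a, b) \<in> ?A" for a b
    using that by (auto simp: hanoi_graph_arc_iff)
  have F_arc: "(F a, F b) \<in> ?A \<longleftrightarrow> (a, b) \<in> ?A" if ab: "a \<in> ?S" "b \<in> ?S" for a b
  proof
    assume A: "(F a, F b) \<in> ?A"
    then obtain y where y: "y < k" "(case_nat y (F a), case_nat y (F b)) \<in> ?A'" using lift by blast
    \<comment> \<open>At this point \<open>s a\<close> and \<open>s b\<close> may differ, so
      \<open>y\<close> is pulled back through each separately; \<open>drop\<close> does not require
      the two pegs to be equal.\<close>
    obtain x x' where x: "x < k" "s a x = y" "x' < k" "s b x' = y"
      using s_surj ab y(1) by metis
    then have "(f (case_nat x a), f (case_nat x' b)) \<in> ?A'" using y ab by (simp add: f_eq)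
    then have "(case_nat x a, case_nat x' b) \<in> ?A'" using arc mem ab x by blast
    then show "(a, b) \<in> ?A" using drop irrefl[OF A] ab x by blast
  next
    assume A: "(a, b) \<in> ?A"
    then obtain x where x: "x < k" "(case_nat x a, case_nat x b) \<in> ?A'" using lift by blast
    then have "(f (case_nat x a), f (case_nat x b)) \<in> ?A'" using arc mem ab by blast
    then have "(case_nat (s a x) (F a), case_nat (s b x) (F b)) \<in> ?A'" using x ab by (simp add: f_eq)
    moreover have "F a \<noteq> F b"
      using irrefl[OF A] inj_onD[OF bij_betw_imp_inj_on[OF F_bij]] ab by blast
    ultimately show "(F a, F b) \<in> ?A" using drop F_in f_in ab x(1) by blast
  qed
  have "F \<in> graph_automorphisms (hanoi_graph k (Suc n))"
    using F_bij F_arc unfolding graph_automorphisms_def Bij_def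
    by (auto simp: hanoi_graph_def F_def)
  from Suc.IH[OF this] obtain \<pi> where \<pi>: "bij_betw \<pi> {..<k} {..<k}"
    and F: "\<And>a i. a \<in> ?S \<Longrightarrow> i < Suc n \<Longrightarrow> F a i = \<pi> (a i)" by blast
  have \<pi>_surj: "\<exists>x<k. \<pi> x = y" if "y < k" for y
    using bij_betw_imp_surj_on[OF \<pi>] that by (metis imageE lessThan_iff)
  have s_eq: "s a x = \<pi> x" if a: "a \<in> ?S" and x: "x < k" for a x
  proof -
    let ?p = "a 0"
    have p: "?p < k" using a by (auto simp: hanoi_states_def)
    \<comment> \<open>Disk 0 of \<open>a\<close> is the second smallest of the whole puzzle and can
      move to any \<open>q\<close> once the smallest disk is off \<open>?p\<close> and
      \<open>q\<close>. The image edge joins different cliques, so there too the smallest disk is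
      off the pegs of the move, which are \<pi> \<open>?p\<close> and \<pi>
      \<open>q\<close>.\<close>
    have avoid: "s a z \<notin> {\<pi> ?p, \<pi> q}" if "z < k" "q < k" "q \<noteq> ?p" "z \<notin> {?p, q}" for z q
    proof -
      let ?b = "a(0 := q)"
      have b: "?b \<in> ?S"
        using a \<open>q < k\<close> by (auto simp: hanoi_states_def PiE_iff extensional_def)
      have ab: "(a, ?b) \<in> ?A"
        unfolding hanoi_graph_arc_iff using a b that by (intro conjI exI[of _ 0]) auto
      then have "(case_nat z a, case_nat z ?b) \<in> ?A'"
        using a b that by (auto simp: hanoi_graph_arc_case_nat_iff)
      then have "(case_nat (s a z) (F a), case_nat (s ?b z) (F ?b)) \<in> ?A'"
        using arc[OF mem mem] a b that by (simp flip: f_eq)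
      moreover have "F a 0 = \<pi> ?p" "F ?b 0 = \<pi> q" using F a b by auto
      moreover have "\<pi> ?p \<noteq> \<pi> q" using inj_on_eq_iff[OF bij_betw_imp_inj_on[OF \<pi>]] p that by simp
      moreover from calculation have "F a \<noteq> F ?b" by metis
      ultimately have "\<forall>i<Suc n. F a i \<noteq> F ?b i \<longrightarrow> s a z \<notin> {F a i, F ?b i}"
        using f_in[OF a \<open>z < k\<close>] f_in[OF b \<open>z < k\<close>]
        by (simp add: hanoi_graph_arc_case_nat_iff del: fun_upd_apply) metis
      then show ?thesis
        using \<open>F a 0 = \<pi> ?p\<close> \<open>F ?b 0 = \<pi> q\<close> \<open>\<pi> ?p \<noteq> \<pi> q\<close> by (metis zero_less_Suc)
    qed
    have not_p: "s a z \<noteq> \<pi> ?p" if "z < k" "z \<noteq> ?p" for z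
    proof -
      \<comment> \<open>Since k is at least 3, there is a target peg \<open>q\<close> other than
        \<open>?p\<close> and \<open>z\<close>, to which \<open>avoid\<close> applies.\<close>
      have "\<not> {..<k} \<subseteq> {?p, z}"
        using card_mono[of "{?p, z}" "{..<k}"] k that by (auto simp: card_insert_if)
      then obtain q where "q < k" "q \<notin> {?p, z}" by blast
      then show ?thesis using avoid[of z q] that by auto
    qed
    show ?thesis
    \<comment> \<open>Surjectivity of \<open>s a\<close> provides a peg sent to \<pi>
      \<open>?p\<close>, and by \<open>not_p\<close> it can only be \<open>?p\<close>. For other
      \<open>x\<close>, write \<open>s a x\<close> as \<pi> \<open>q\<close>: then \<open>q\<close>
      is not \<open>?p\<close>, and \<open>avoid\<close> for this \<open>q\<close> leaves only
      \<open>x = q\<close>.\<close>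
    proof (cases "x = ?p")
      case True
      have "\<pi> ?p < k" using bij_betwE[OF \<pi>] p by simp
      then show ?thesis using s_surj[OF a] not_p True by metis
    next
      case False
      obtain q where q: "q < k" "\<pi> q = s a x" using \<pi>_surj f_in[OF a x] by metis
      then have "q \<noteq> ?p" using not_p[OF x False] by metis
      then have "x = q" using avoid[OF x q(1)] q(2) False by auto
      with q show ?thesis by simp
    qed
  qed
  have "f a i = \<pi> (a i)" if "a \<in> ?S'" "i < Suc (Suc n)" for a i
    using that(1)
  proof (rule hanoi_states_SucE)
    fix x b assume "a = case_nat x b" "x < k" "b \<in> ?S"
    then show ?thesis using that(2) by (cases i) (auto simp: f_eq s_eq F)
  qed
  with \<pi> show ?case by blast
qed

section \<open>Peg permutations as automorphisms\<close>

(* The symmetric group of the library acts on {1..k}, whereas pegs are numbered from 0. *)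
definition relabel_pegs :: "nat \<Rightarrow> nat \<Rightarrow> (nat \<Rightarrow> nat) \<Rightarrow> (nat \<Rightarrow> nat) \<Rightarrow> nat \<Rightarrow> nat" where
  "relabel_pegs k n \<sigma> = (\<lambda>a\<in>hanoi_states k n. \<lambda>i\<in>{..<n}. \<sigma> (Suc (a i)) - 1)"

text \<open>The lower bound makes the truncated subtraction in \<open>relabel_pegs\<close> lossless;
  the upper bound keeps its result among the pegs.\<close>

lemma permutes_Suc_bounds:
  assumes "\<sigma> permutes {1..k}" "x < k"
  shows "1 \<le> \<sigma> (Suc x)" "\<sigma> (Suc x) \<le> k"
  using permutes_in_image[OF assms(1), of "Suc x"] assms(2) by auto

lemma relabel_pegs_in_states:
  assumes "\<sigma> permutes {1..k}" "a \<in> hanoi_states k n"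
  shows "relabel_pegs k n \<sigma> a \<in> hanoi_states k n"
proof -
  have "\<sigma> (Suc (a i)) - 1 < k" if "i < n" for i
  proof -
    have "a i < k" using assms(2) that by (auto simp: hanoi_states_def)
    then show ?thesis using permutes_Suc_bounds[OF assms(1)] by fastforce
  qed
  then show ?thesis using assms(2) by (auto simp: relabel_pegs_def hanoi_states_def)
qed

text \<open>Between the two relabelings a peg is shifted down and up again, which cancels because
  \<tau> has values at least 1 here. This gives both the homomorphism property and the inverse of a
  relabeling.\<close>

lemma relabel_pegs_comp:
  assumes "\<sigma> permutes {1..k}" "\<tau> permutes {1..k}" "a \<in> hanoi_states k n"
  shows "relabel_pegs k n (\<sigma> \<circ> \<tau>) a = relabel_pegs k n \<sigma> (relabel_pegs k n \<tau> a)"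
proof
  fix i
  have "Suc (\<tau> (Suc (a i)) - 1) = \<tau> (Suc (a i))" if "i < n"
  proof -
    have "a i < k" using assms(3) that by (auto simp: hanoi_states_def)
    then show ?thesis using permutes_Suc_bounds[OF assms(2)] by fastforce
  qed
  then show "relabel_pegs k n (\<sigma> \<circ> \<tau>) a i = relabel_pegs k n \<sigma> (relabel_pegs k n \<tau> a) i"
    using assms relabel_pegs_in_states[OF assms(2,3)] by (auto simp: relabel_pegs_def)
qed

lemma relabel_pegs_id: "a \<in> hanoi_states k n \<Longrightarrow> relabel_pegs k n id a = a"
  by (auto simp: relabel_pegs_def hanoi_states_def PiE_iff extensional_def)

text \<open>Adjacency only asks which pegs are equal and which are different, and an injective
  relabeling preserves both.\<close>

lemma relabel_pegs_automorphism:
  assumes \<sigma>: "\<sigma> permutes {1..k}"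
  shows "relabel_pegs k n \<sigma> \<in> graph_automorphisms (hanoi_graph k n)"
proof -
  let ?S = "hanoi_states k n" and ?r = "relabel_pegs k n"
  note \<sigma>' = permutes_inv[OF \<sigma>]
  have "bij_betw (?r \<sigma>) ?S ?S"
  proof (rule bij_betw_byWitness[of _ "?r (inv' \<sigma>)"])
    show "\<forall>a\<in>?S. ?r (inv' \<sigma>) (?r \<sigma> a) = a" "\<forall>a\<in>?S. ?r \<sigma> (?r (inv' \<sigma>) a) = a"
      using relabel_pegs_comp[OF \<sigma>' \<sigma>, of _ n, symmetric] relabel_pegs_comp[OF \<sigma> \<sigma>', of _ n, symmetric]
      by (simp_all add: permutes_inv_o[OF \<sigma>] relabel_pegs_id)
  qed (use relabel_pegs_in_states \<sigma> \<sigma>' in blast)+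
  moreover have "(?r \<sigma> a, ?r \<sigma> b) \<in> parcs (hanoi_graph k n) \<longleftrightarrow> (a, b) \<in> parcs (hanoi_graph k n)"
    if ab: "a \<in> ?S" "b \<in> ?S" for a b
  proof -
    have inj: "\<sigma> (Suc x) - 1 = \<sigma> (Suc y) - 1 \<longleftrightarrow> x = y" if "x < k" "y < k" for x y
      using permutes_Suc_bounds[OF \<sigma> that(1)] permutes_Suc_bounds[OF \<sigma> that(2)]
        inj_eq[OF permutes_inj[OF \<sigma>], of "Suc x" "Suc y"] by auto
    have lt: "a i < k" "b i < k" if "i < n" for i
      using ab that by (auto simp: hanoi_states_def)
    have r: "?r \<sigma> a i = \<sigma> (Suc (a i)) - 1" "?r \<sigma> b i = \<sigma> (Suc (b i)) - 1" if "i < n" for i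
      using ab that by (auto simp: relabel_pegs_def)
    have eq: "?r \<sigma> a i = ?r \<sigma> b j \<longleftrightarrow> a i = b j" "?r \<sigma> a i = ?r \<sigma> a j \<longleftrightarrow> a i = a j"
      if "i < n" "j < n" for i j
      using that lt by (simp_all only: r inj)
    show ?thesis
      unfolding hanoi_graph_arc_iff using ab relabel_pegs_in_states[OF \<sigma>]
      by (simp add: eq cong: conj_cong)
  qed
  ultimately show ?thesis
    by (auto simp: graph_automorphisms_def Bij_def hanoi_graph_def relabel_pegs_def)
qed

lemma relabel_pegs_surj:
  assumes k: "k \<ge> 3" and n: "n \<ge> 1" and f: "f \<in> graph_automorphisms (hanoi_graph k n)"
  shows "\<exists>\<sigma>. \<sigma> permutes {1..k} \<and> f = relabel_pegs k n \<sigma>"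
proof -
  obtain \<pi> where \<pi>: "bij_betw \<pi> {..<k} {..<k}"
    and f\<pi>: "\<And>a i. a \<in> hanoi_states k n \<Longrightarrow> i < n \<Longrightarrow> f a i = \<pi> (a i)"
    using hanoi_automorphism_peg_permutation[OF k, of f "n - 1"] f n by auto
  \<comment> \<open>The permutation \<pi> conjugated by the shift from pegs to
    \<open>{1..k}\<close>, fixing everything else as \<open>permutes\<close> requires.\<close>
  define \<sigma> where "\<sigma> x = (if x \<in> {1..k} then Suc (\<pi> (x - 1)) else x)" for x
  have "bij_betw (\<lambda>x. x - 1) {1..k} {..<k}"
    by (rule bij_betw_byWitness[of _ Suc]) auto
  moreover have "bij_betw Suc {..<k} {1..k}"
    by (rule bij_betw_byWitness[of _ "\<lambda>x. x - 1"]) auto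
  ultimately have "bij_betw (Suc \<circ> (\<pi> \<circ> (\<lambda>x. x - 1))) {1..k} {1..k}"
    using \<pi> bij_betw_trans by blast
  then have "bij_betw \<sigma> {1..k} {1..k}"
    by (rule bij_betw_cong[THEN iffD1, rotated]) (auto simp: \<sigma>_def)
  then have "\<sigma> permutes {1..k}"
    by (rule bij_imp_permutes) (auto simp: \<sigma>_def)
  \<comment> \<open>Equality of total functions: off the states, and at indices that are not disks,
    both sides are \<open>undefined\<close>.\<close>
  moreover have "f = relabel_pegs k n \<sigma>"
  proof
    fix a
    have B: "f \<in> Bij (hanoi_states k n)"
      using f by (simp add: graph_automorphisms_def hanoi_graph_def)
    show "f a = relabel_pegs k n \<sigma> a"
    proof (cases "a \<in> hanoi_states k n")
      case True
      then have "f a \<in> hanoi_states k n" using B Bij_imp_funcset by blast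
      show ?thesis
      proof
        fix i
        show "f a i = relabel_pegs k n \<sigma> a i"
        proof (cases "i < n")
          case i: True
          then have "a i < k" using True by (auto simp: hanoi_states_def)
          then show ?thesis using True f\<pi>[OF True i] i by (simp add: relabel_pegs_def \<sigma>_def)
        next
          case False
          then show ?thesis
            using True \<open>f a \<in> _\<close>
            by (simp add: relabel_pegs_def hanoi_states_def PiE_iff extensional_def)
        qed
      qed
    next
      case False
      then show ?thesis
        using B by (auto simp: relabel_pegs_def Bij_def extensional_def)
    qed
  qed
  ultimately show ?thesis by blast
qed

text \<open>The state with all disks on one peg reveals the image of that peg; disk 0, present
  because \<open>n \<ge> 1\<close>, is the one inspected.\<close>

lemma relabel_pegs_inj:
  assumes n: "n \<ge> 1" and \<sigma>: "\<sigma> permutes {1..k}" and \<tau>: "\<tau> permutes {1..k}"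
    and eq: "relabel_pegs k n \<sigma> = relabel_pegs k n \<tau>"
  shows "\<sigma> = \<tau>"
proof
  fix x
  show "\<sigma> x = \<tau> x"
  proof (cases "x \<in> {1..k}")
    case True
    then obtain y where y: "x = Suc y" "y < k" by (cases x) auto
    have "(\<lambda>i\<in>{..<n}. y) \<in> hanoi_states k n" using y by (auto simp: hanoi_states_def)
    then have "\<sigma> (Suc y) - 1 = \<tau> (Suc y) - 1"
      using fun_cong[OF fun_cong[OF eq, of "\<lambda>i\<in>{..<n}. y"], of 0] n by (auto simp: relabel_pegs_def)
    then show ?thesis
      using permutes_Suc_bounds[OF \<sigma> y(2)] permutes_Suc_bounds[OF \<tau> y(2)] y(1) by simp
  next
    case False
    then show ?thesis using \<sigma> \<tau> by (simp add: permutes_not_in)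
  qed
qed

section \<open>The isomorphism with the symmetric group\<close>

theorem mainTheorem1:
  fixes k n :: nat
  assumes "k \<ge> 3" and "n \<ge> 1"
  shows "graph_aut_group (hanoi_graph k n) \<cong> sym_group k"
proof -
  let ?G = "graph_aut_group (hanoi_graph k n)"
  have carrier: "carrier ?G = graph_automorphisms (hanoi_graph k n)"
    by (simp add: graph_aut_group_def)
  have "relabel_pegs k n \<in> hom (sym_group k) ?G"
  proof (rule homI)
    fix \<sigma> \<tau> assume "\<sigma> \<in> carrier (sym_group k)" "\<tau> \<in> carrier (sym_group k)"
    then have p: "\<sigma> permutes {1..k}" "\<tau> permutes {1..k}" by (auto simp: sym_group_def)
    have B: "relabel_pegs k n \<rho> \<in> Bij (hanoi_states k n)" if "\<rho> permutes {1..k}" for \<rho>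
      using relabel_pegs_automorphism[OF that, of n]
      by (simp add: graph_automorphisms_def hanoi_graph_def)
    \<comment> \<open>The group operation is composition restricted to the states, so arguments that
      are not states must be compared as well; there both sides are
      \<open>undefined\<close>.\<close>
    have "relabel_pegs k n (\<sigma> \<circ> \<tau>) =
        compose (hanoi_states k n) (relabel_pegs k n \<sigma>) (relabel_pegs k n \<tau>)"
    proof
      fix a
      show "relabel_pegs k n (\<sigma> \<circ> \<tau>) a =
          compose (hanoi_states k n) (relabel_pegs k n \<sigma>) (relabel_pegs k n \<tau>) a"
        using relabel_pegs_comp[OF p, of a n]
        by (cases "a \<in> hanoi_states k n") (simp_all add: compose_def relabel_pegs_def[of k n "\<sigma> \<circ> \<tau>"])
    qed
    then show "relabel_pegs k n (\<sigma> \<otimes>\<^bsub>sym_group k\<^esub> \<tau>) =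
        relabel_pegs k n \<sigma> \<otimes>\<^bsub>?G\<^esub> relabel_pegs k n \<tau>"
      using B p by (simp add: graph_aut_group_def BijGroup_def sym_group_def hanoi_graph_def)
  qed (simp add: carrier sym_group_def relabel_pegs_automorphism)
  moreover have "bij_betw (relabel_pegs k n) (carrier (sym_group k)) (carrier ?G)"
    unfolding bij_betw_def inj_on_def carrier
    using relabel_pegs_inj[OF assms(2)] relabel_pegs_surj[OF assms] relabel_pegs_automorphism
    by (fastforce simp: sym_group_def)
  ultimately have "sym_group k \<cong> ?G"
    unfolding is_iso_def iso_def by blast
  then show ?thesis
    by (rule group.iso_sym[OF sym_group_is_group])
qed

end
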